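(* Let $S$ be a densely defined, closed, symmetric operator in a Hilbert space $\mathcal H$ and let $\{\mathcal G,\Gamma_0,\Gamma_1\}$ be a quasi boundary triple for $T\subset S^*$ with corresponding $\gamma$-field $\gamma$ and Weyl function $M$; let $A_0=T\upharpoonright\ker\Gamma_0$ and $A_1=T\upharpoonright\ker\Gamma_1$. Let $B$ be a bounded self-adjoint operator in $\mathcal G$ and assume that there exist $\lambda_+\in\mathbb C^+$ and $\lambda_-\in\mathbb C^-$ such that the following conditions are satisfied (those involving $\lambda_\pm$ being required for both $\lambda_+$ and $\lambda_-$): (i) $1\in\rho\bigl(B\overline{M(\lambda_\pm)}\bigr)$; (ii) $B\bigl(\operatorname{ran}\overline{M(\lambda_\pm)}\bigr)\subset\operatorname{ran}\Gamma_0$; (iii) $B(\operatorname{ran}\Gamma_1)\subset\operatorname{ran}\Gamma_0$, or $A_1$ is self-adjoint. Then the operator $$A_{[B]}f=Tf,\qquad \operatorname{dom}A_{[B]}=\bigl\{f\in\operatorname{dom}T:\Gamma_0 f=B\Gamma_1 f\bigr\},$$ is a self-adjoint extension of $S$, and $$(A_{[B]}-\lambda)^{-1}=(A_0-\lambda)^{-1}+\gamma(\lambda)\bigl(I-BM(\lambda)\bigr)^{-1}B\gamma(\overline\lambda)^*$$ holds for all $\lambda\in\rho(A_{[B]})\cap\rho(A_0)$.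
   Context: $\mathbb C^+$ and $\mathbb C^-$ denote the open upper and lower half-planes. Let $S$ be a densely defined, closed, symmetric operator in $\mathcal H$, and let $T\subset S^*$ be a linear operator with $\overline T=S^*$. A triple $\{\mathcal G,\Gamma_0,\Gamma_1\}$ is a quasi boundary triple for $T\subset S^*$ if $\mathcal G$ is a Hilbert space and $\Gamma_0,\Gamma_1:\operatorname{dom}T\to\mathcal G$ are linear maps such that: (1) $(Tf,g)-(f,Tg)=(\Gamma_1f,\Gamma_0g)-(\Gamma_0f,\Gamma_1g)$ for all $f,g\in\operatorname{dom}T$; (2) $(\Gamma_0,\Gamma_1)^\top:\operatorname{dom}T\to\mathcal G\times\mathcal G$ has dense range; (3) $A_0:=T\upharpoonright\ker\Gamma_0$ is self-adjoint in $\mathcal H$. Put $A_1:=T\upharpoonright\ker\Gamma_1$ (not necessarily self-adjoint). For $\lambda\in\rho(A_0)$ one has $\operatorname{dom}T=\ker\Gamma_0\,\dot+\,\ker(T-\lambda)$, so $\Gamma_0\upharpoonright\ker(T-\lambda)$ is injective with range $\operatorname{ran}\Gamma_0$. The $\gamma$-field is $\gamma(\lambda):=(\Gamma_0\upharpoonright\ker(T-\lambda))^{-1}$ (mapping $\operatorname{ran}\Gamma_0\subset\mathcal G$ onto $\ker(T-\lambda)$), and the Weyl function is $M(\lambda):=\Gamma_1\gamma(\lambda)$, an operator in $\mathcal G$ with domain $\operatorname{ran}\Gamma_0$, $\lambda\in\rho(A_0)$. One has $M(\lambda)\subset M(\overline\lambda)^*$, so $M(\lambda)$ is closable; $\overline{M(\lambda)}$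 denotes its closure. The adjoint $\gamma(\lambda)^*$ is bounded and everywhere defined from $\mathcal H$ to $\mathcal G$. *)

theory Defs
  imports "HOL-Analysis.Analysis"
begin

section \<open>Complex Hilbert spaces\<close>

class complex_vector = real_vector +
  fixes scaleC :: "complex \<Rightarrow> 'a \<Rightarrow> 'a"  (infixr \<open>*\<^sub>C\<close> 75)
  assumes scaleC_add_right: "c *\<^sub>C (x + y) = c *\<^sub>C x + c *\<^sub>C y"
    and scaleC_add_left: "(c + d) *\<^sub>C x = c *\<^sub>C x + d *\<^sub>C x"
    and scaleC_scaleC: "c *\<^sub>C (d *\<^sub>C x) = (c * d) *\<^sub>C x"
    and scaleR_scaleC: "r *\<^sub>R x = complex_of_real r *\<^sub>C x"

text \<open>
  The inner product is linear in its first argument.  Completeness and the metric come from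
  \<^class>\<open>banach\<close>; the last axiom says that the norm is the one induced by the inner product
  and thereby gives positive definiteness.
\<close>

class complex_hilbert = complex_vector + banach +
  fixes cinner :: "'a \<Rightarrow> 'a \<Rightarrow> complex"
  assumes cinner_commute: "cinner x y = cnj (cinner y x)"
    and cinner_add_left: "cinner (x + y) z = cinner x z + cinner y z"
    and cinner_scaleC_left: "cinner (c *\<^sub>C x) y = c * cinner x y"
    and cinner_norm: "cinner x x = complex_of_real ((norm x)\<^sup>2)"

instantiation complex :: complex_hilbert
begin

definition scaleC_complex :: "complex \<Rightarrow> complex \<Rightarrow> complex"
  where "scaleC_complex c x = c * x"

definition cinner_complex :: "complex \<Rightarrow> complex \<Rightarrow> complex"
  where "cinner_complex x y = x * cnj y"

instance
proof
  fix x :: complex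
  show "cinner x x = complex_of_real ((norm x)\<^sup>2)"
    by (simp only: cinner_complex_def complex_norm_square)
qed (simp_all add: scaleC_complex_def cinner_complex_def algebra_simps scaleR_conv_of_real)

end


section \<open>Linear operators\<close>

text \<open>
  A (not necessarily everywhere defined) linear operator is identified with its graph.  Thus
  the domain and range are \<^const>\<open>Domain\<close> and \<^const>\<open>Range\<close>, extension is inclusion, an operator
  is closed iff its graph is, and the closure of an operator is the \<^const>\<open>closure\<close> of its graph.
\<close>

definition linear_operator :: "('a::complex_vector \<times> 'b::complex_vector) set \<Rightarrow> bool" where
  "linear_operator A \<longleftrightarrow> single_valued A \<and> (0, 0) \<in> A \<and>
     (\<forall>f f' g g'. (f, f') \<in> A \<longrightarrow> (g, g') \<in> A \<longrightarrow> (f + g, f' + g') \<in> A) \<and>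
     (\<forall>c f f'. (f, f') \<in> A \<longrightarrow> (c *\<^sub>C f, c *\<^sub>C f') \<in> A)"

definition op_apply :: "('a \<times> 'b) set \<Rightarrow> 'a \<Rightarrow> 'b"  (infixl \<open>\<bullet>\<^sub>o\<close> 95) where
  "A \<bullet>\<^sub>o f = (THE g. (f, g) \<in> A)"

definition op_ker :: "('a \<times> 'b::zero) set \<Rightarrow> 'a set" where
  "op_ker A = {f. (f, 0) \<in> A}"

definition op_restrict :: "('a \<times> 'b) set \<Rightarrow> 'a set \<Rightarrow> ('a \<times> 'b) set"  (infixl \<open>\<restriction>\<^sub>o\<close> 80) where
  "A \<restriction>\<^sub>o D = {(f, g) \<in> A. f \<in> D}"

definition op_add :: "('a \<times> 'b::plus) set \<Rightarrow> ('a \<times> 'b) set \<Rightarrow> ('a \<times> 'b) set"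
    (infixl \<open>+\<^sub>o\<close> 65) where
  "A +\<^sub>o B = {(f, g + h) | f g h. (f, g) \<in> A \<and> (f, h) \<in> B}"

definition op_diff :: "('a \<times> 'b::minus) set \<Rightarrow> ('a \<times> 'b) set \<Rightarrow> ('a \<times> 'b) set"
    (infixl \<open>-\<^sub>o\<close> 65) where
  "A -\<^sub>o B = {(f, g - h) | f g h. (f, g) \<in> A \<and> (f, h) \<in> B}"

text \<open>
  The operator product \<open>B A\<close> (first \<open>A\<close>, then \<open>B\<close>), on its natural domain; note that relational
  composition \<open>O\<close> takes its arguments in the opposite order.
\<close>

definition op_mult :: "('b \<times> 'c) set \<Rightarrow> ('a \<times> 'b) set \<Rightarrow> ('a \<times> 'c) set"
    (infixr \<open>\<odot>\<^sub>o\<close> 70) where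
  "B \<odot>\<^sub>o A = A O B"

definition scalar_op :: "complex \<Rightarrow> ('a::complex_vector \<times> 'a) set" where
  "scalar_op \<mu> = {(f, \<mu> *\<^sub>C f) | f. True}"

text \<open>
  The inverse of an operator \<open>A\<close> is \<open>A\<inverse>\<close> (\<^const>\<open>converse\<close>), which is an operator iff \<open>A\<close> is
  injective.
\<close>

definition op_injective :: "('a \<times> 'b) set \<Rightarrow> bool" where
  "op_injective A \<longleftrightarrow> single_valued (A\<inverse>)"

definition op_bounded :: "('a::real_normed_vector \<times> 'b::real_normed_vector) set \<Rightarrow> bool" where
  "op_bounded A \<longleftrightarrow> (\<exists>K. \<forall>(f, g) \<in> A. norm g \<le> K * norm f)"

definition densely_defined :: "('a::topological_space \<times> 'b) set \<Rightarrow> bool" where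
  "densely_defined A \<longleftrightarrow> closure (Domain A) = UNIV"

text \<open>For densely defined \<open>A\<close> this is the graph of the adjoint operator.\<close>

definition op_adjoint ::
    "('a::complex_hilbert \<times> 'b::complex_hilbert) set \<Rightarrow> ('b \<times> 'a) set"
    (\<open>_\<^sup>*\<^sub>o\<close> [1000] 999) where
  "A\<^sup>*\<^sub>o = {(g, g'). \<forall>(f, f') \<in> A. cinner f' g = cinner f g'}"

definition symmetric_operator :: "('a::complex_hilbert \<times> 'a) set \<Rightarrow> bool" where
  "symmetric_operator A \<longleftrightarrow>
     (\<forall>(f, f') \<in> A. \<forall>(g, g') \<in> A. cinner f' g = cinner f g')"

definition self_adjoint :: "('a::complex_hilbert \<times> 'a) set \<Rightarrow> bool" where
  "self_adjoint A \<longleftrightarrow> linear_operator A \<and> densely_defined A \<and> A\<^sup>*\<^sub>o = A"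

text \<open>
  No closedness of \<open>A\<close> is presupposed; it follows as soon as the resolvent set is nonempty.
\<close>

definition resolvent_set :: "('a::complex_hilbert \<times> 'a) set \<Rightarrow> complex set" where
  "resolvent_set A = {\<mu>. op_injective (A -\<^sub>o scalar_op \<mu>) \<and> Range (A -\<^sub>o scalar_op \<mu>) = UNIV \<and>
     op_bounded ((A -\<^sub>o scalar_op \<mu>)\<inverse>)}"


section \<open>Quasi boundary triples\<close>

definition quasi_boundary_triple ::
    "('h::complex_hilbert \<times> 'h) set \<Rightarrow> ('h \<times> 'h) set \<Rightarrow>
     ('h \<times> 'g::complex_hilbert) set \<Rightarrow> ('h \<times> 'g) set \<Rightarrow> bool" where
  "quasi_boundary_triple S T \<Gamma>\<^sub>0 \<Gamma>\<^sub>1 \<longleftrightarrow>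
     linear_operator T \<and> T \<subseteq> S\<^sup>*\<^sub>o \<and> closure T = S\<^sup>*\<^sub>o \<and>
     linear_operator \<Gamma>\<^sub>0 \<and> Domain \<Gamma>\<^sub>0 = Domain T \<and>
     linear_operator \<Gamma>\<^sub>1 \<and> Domain \<Gamma>\<^sub>1 = Domain T \<and>
     (\<forall>f \<in> Domain T. \<forall>g \<in> Domain T.
        cinner (T \<bullet>\<^sub>o f) g - cinner f (T \<bullet>\<^sub>o g) =
        cinner (\<Gamma>\<^sub>1 \<bullet>\<^sub>o f) (\<Gamma>\<^sub>0 \<bullet>\<^sub>o g) - cinner (\<Gamma>\<^sub>0 \<bullet>\<^sub>o f) (\<Gamma>\<^sub>1 \<bullet>\<^sub>o g)) \<and>
     closure {(\<Gamma>\<^sub>0 \<bullet>\<^sub>o f, \<Gamma>\<^sub>1 \<bullet>\<^sub>o f) | f. f \<in> Domain T} = UNIV \<and>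
     self_adjoint (T \<restriction>\<^sub>o op_ker \<Gamma>\<^sub>0)"

definition gamma_field ::
    "('h::complex_hilbert \<times> 'h) set \<Rightarrow> ('h \<times> 'g::complex_hilbert) set \<Rightarrow> complex \<Rightarrow>
     ('g \<times> 'h) set" where
  "gamma_field T \<Gamma>\<^sub>0 \<mu> = (\<Gamma>\<^sub>0 \<restriction>\<^sub>o op_ker (T -\<^sub>o scalar_op \<mu>))\<inverse>"

definition weyl_function ::
    "('h::complex_hilbert \<times> 'h) set \<Rightarrow> ('h \<times> 'g::complex_hilbert) set \<Rightarrow> ('h \<times> 'g) set \<Rightarrow>
     complex \<Rightarrow> ('g \<times> 'g) set" where
  "weyl_function T \<Gamma>\<^sub>0 \<Gamma>\<^sub>1 \<mu> = \<Gamma>\<^sub>1 \<odot>\<^sub>o gamma_field T \<Gamma>\<^sub>0 \<mu>"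

definition boundary_extension ::
    "('h::complex_hilbert \<times> 'h) set \<Rightarrow> ('h \<times> 'g::complex_hilbert) set \<Rightarrow> ('h \<times> 'g) set \<Rightarrow>
     ('g \<times> 'g) set \<Rightarrow> ('h \<times> 'h) set" where
  "boundary_extension T \<Gamma>\<^sub>0 \<Gamma>\<^sub>1 B =
     T \<restriction>\<^sub>o {f \<in> Domain T. \<Gamma>\<^sub>0 \<bullet>\<^sub>o f = B \<bullet>\<^sub>o (\<Gamma>\<^sub>1 \<bullet>\<^sub>o f)}"

end

theory Submission
  imports Defs
begin

text \<open>
  Write \<open>A\<^sub>B\<close> for the extension given by \<open>\<Gamma>\<^sub>0 f = B \<Gamma>\<^sub>1 f\<close>.  Green's identity and the symmetry of \<open>B\<close>
  make \<open>A\<^sub>B\<close> symmetric, so the point is to prove that \<open>A\<^sub>B - \<mu>\<close> is onto for one \<open>\<mu>\<close> in each open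
  half-plane; by \<open>symmetric_surj_imp_adjoint_eq\<close> this suffices, even if the two points are not
  conjugate.

  To solve \<open>(A\<^sub>B - \<mu>) f = h\<close>, start from the solution \<open>k = (A\<^sub>0 - \<mu>)\<inverse> h\<close> and correct its boundary
  values by an eigenvector \<open>\<gamma>(\<mu>) \<phi>\<close> of \<open>T\<close>.  The boundary condition turns into
  \<open>\<phi> - B M(\<mu>) \<phi> = B \<Gamma>\<^sub>1 k\<close>.  The resolvent hypothesis solves this equation with the closure of
  \<open>M(\<mu>)\<close> in place of \<open>M(\<mu>)\<close>, and the range hypotheses put the solution \<open>\<phi>\<close> back into the range of
  \<open>\<Gamma>\<^sub>0\<close>, the domain of \<open>M(\<mu>)\<close> (\<open>boundary_extension_surj\<close>).  If \<open>A\<^sub>1\<close> is self-adjoint, the range of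
  \<open>\<Gamma>\<^sub>1\<close> is that of \<open>M(\<mu>)\<close>, so that one range condition implies the other
  (\<open>range_\<Gamma>1_subset_range_weyl\<close>).

  Since \<open>\<Gamma>\<^sub>1 (A\<^sub>0 - \<mu>)\<inverse> = \<gamma>(cnj \<mu>)\<^sup>*\<^sub>o\<close> (\<open>adjoint_gamma_field\<close>), the same computation read at an
  arbitrary common regular point is the resolvent formula (\<open>krein_formula\<close>).

  The main analytic ingredient is that a self-adjoint operator minus a nonreal number is onto
  (\<open>self_adjoint_surj\<close>), which rests on the projection theorem (\<open>closed_subspace_eq_UNIV\<close>).
\<close>

section \<open>Geometry of complex Hilbert spaces\<close>

lemma scaleC_zero_left [simp]: "0 *\<^sub>C x = (0::'a::complex_vector)"
  using scaleR_scaleC[of 0 x] by simp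

lemma scaleC_one [simp]: "1 *\<^sub>C x = (x::'a::complex_vector)"
  using scaleR_scaleC[of 1 x] by simp

lemma scaleC_minus_one: "(- 1) *\<^sub>C x = - (x::'a::complex_vector)"
  using scaleR_scaleC[of "- 1" x] by simp

lemma scaleC_zero_right [simp]: "c *\<^sub>C 0 = (0::'a::complex_vector)"
  using scaleC_add_right[of c 0 "0::'a"] by simp

lemma scaleC_minus_right: "c *\<^sub>C (- x) = - (c *\<^sub>C (x::'a::complex_vector))"
  using scaleC_add_right[of c x "- x"] by (simp add: eq_neg_iff_add_eq_0 add.commute)

lemma scaleC_diff_right: "c *\<^sub>C (x - y) = c *\<^sub>C x - c *\<^sub>C (y::'a::complex_vector)"
  using scaleC_add_right[of c x "- y"] by (simp add: scaleC_minus_right)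

lemma cnj_cinner [simp]: "cnj (cinner x y) = cinner y (x::'a::complex_hilbert)"
  by (rule cinner_commute[symmetric])

lemma cinner_add_right: "cinner x (y + z) = cinner x y + cinner x (z::'a::complex_hilbert)"
  using arg_cong[OF cinner_add_left[of y z x], of cnj] by simp

lemma cinner_scaleC_right: "cinner x (c *\<^sub>C y) = cnj c * cinner x (y::'a::complex_hilbert)"
  using arg_cong[OF cinner_scaleC_left[of c y x], of cnj] by simp

lemma cinner_zero_left [simp]: "cinner 0 (x::'a::complex_hilbert) = 0"
  using cinner_add_left[of 0 0 x] by simp

lemma cinner_zero_right [simp]: "cinner (x::'a::complex_hilbert) 0 = 0"
  using cinner_add_right[of x 0 0] by simp

lemma cinner_diff_left: "cinner (x - y) z = cinner x z - cinner y (z::'a::complex_hilbert)"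
  using cinner_add_left[of "x - y" y z] by simp

lemma cinner_diff_right: "cinner x (y - z) = cinner x y - cinner x (z::'a::complex_hilbert)"
  using cinner_add_right[of x "y - z" z] by simp

lemmas cinner_simps = cinner_add_left cinner_add_right cinner_diff_left cinner_diff_right
  cinner_scaleC_left cinner_scaleC_right

lemma Re_cinner_commute: "Re (cinner x y) = Re (cinner y (x::'a::complex_hilbert))"
  using arg_cong[OF cinner_commute[of x y], of Re] by (simp del: cnj_cinner)

lemma cinner_self_eq_0: "cinner x x = 0 \<Longrightarrow> (x::'a::complex_hilbert) = 0"
  by (simp add: cinner_norm)

lemma norm_add_square:
  "(norm (x + y))\<^sup>2 = (norm x)\<^sup>2 + 2 * Re (cinner x y) + (norm (y::'a::complex_hilbert))\<^sup>2"
proof -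
  have "Re (cinner (x + y) (x + y)) =
      Re (cinner x x) + 2 * Re (cinner x y) + Re (cinner y y)"
    using Re_cinner_commute[of x y] by (simp add: cinner_simps)
  then show ?thesis by (simp add: cinner_norm)
qed

lemma norm_diff_square:
  "(norm (x - y))\<^sup>2 = (norm x)\<^sup>2 - 2 * Re (cinner x y) + (norm (y::'a::complex_hilbert))\<^sup>2"
proof -
  have "Re (cinner (x - y) (x - y)) =
      Re (cinner x x) - 2 * Re (cinner x y) + Re (cinner y y)"
    using Re_cinner_commute[of x y] by (simp add: cinner_simps)
  then show ?thesis by (simp add: cinner_norm)
qed

lemma norm_scaleC: "norm (c *\<^sub>C x) = cmod c * norm (x::'a::complex_hilbert)"
proof -
  have "complex_of_real ((norm (c *\<^sub>C x))\<^sup>2) = (c * cnj c) * complex_of_real ((norm x)\<^sup>2)"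
    by (simp only: cinner_norm[symmetric] cinner_simps) simp
  also have "\<dots> = complex_of_real ((cmod c * norm x)\<^sup>2)"
    by (simp add: complex_norm_square[symmetric] power_mult_distrib)
  finally have "(norm (c *\<^sub>C x))\<^sup>2 = (cmod c * norm x)\<^sup>2"
    by (simp only: of_real_eq_iff)
  then show ?thesis by simp
qed

lemma tendsto_scaleC:
  fixes f :: "'b \<Rightarrow> 'a::complex_hilbert"
  assumes "(f \<longlongrightarrow> a) F"
  shows "((\<lambda>t. c *\<^sub>C f t) \<longlongrightarrow> c *\<^sub>C a) F"
proof -
  have "((\<lambda>t. cmod c * norm (f t - a)) \<longlongrightarrow> cmod c * 0) F"
    using assms by (intro tendsto_intros) (simp add: LIM_zero tendsto_norm_zero)
  then have "((\<lambda>t. norm (c *\<^sub>C f t - c *\<^sub>C a)) \<longlongrightarrow> 0) F"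
    by (simp only: norm_scaleC scaleC_diff_right[symmetric] mult_zero_right)
  then show ?thesis
    by (rule LIM_zero_cancel[OF tendsto_norm_zero_cancel])
qed

text \<open>
  Polarization expresses the inner product through the norm, from which it inherits continuity.
\<close>

lemma tendsto_cinner:
  fixes f g :: "'b \<Rightarrow> 'a::complex_hilbert"
  assumes "(f \<longlongrightarrow> a) F" and "(g \<longlongrightarrow> b) F"
  shows "((\<lambda>t. cinner (f t) (g t)) \<longlongrightarrow> cinner a b) F"
proof -
  have Re: "Re (cinner x y) = ((norm (x + y))\<^sup>2 - (norm (x - y))\<^sup>2) / 4" for x y :: 'a
    by (simp add: norm_add_square norm_diff_square)
  have Im: "Im (cinner x y) = Re (cinner x (\<i> *\<^sub>C y))" for x y :: 'a
    by (simp add: cinner_simps)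
  have re: "((\<lambda>t. Re (cinner (f t) (h t))) \<longlongrightarrow> Re (cinner a c)) F"
    if "(h \<longlongrightarrow> c) F" for h c
    unfolding Re by (intro tendsto_intros assms(1) that) simp
  show ?thesis
    using re[OF assms(2)] re[OF tendsto_scaleC[OF assms(2), of \<i>]]
    by (simp add: tendsto_complex_iff Im)
qed

lemma continuous_on_cinner [continuous_intros]:
  fixes f g :: "'b::topological_space \<Rightarrow> 'a::complex_hilbert"
  assumes "continuous_on X f" and "continuous_on X g"
  shows "continuous_on X (\<lambda>t. cinner (f t) (g t))"
  using assms unfolding continuous_on_def by (auto intro: tendsto_cinner)

lemma parallelogram_law:
  fixes x y :: "'a::complex_hilbert"
  shows "(norm (x + y))\<^sup>2 + (norm (x - y))\<^sup>2 = 2 * (norm x)\<^sup>2 + 2 * (norm y)\<^sup>2"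
  by (simp add: norm_add_square norm_diff_square)

text \<open>
  If \<open>z\<close> and \<open>w\<close> were not orthogonal, subtracting from \<open>z\<close> its component along \<open>w\<close> would make it
  shorter.
\<close>

lemma orthogonal_if_shortest:
  fixes z w :: "'a::complex_hilbert"
  assumes "\<And>c. norm z \<le> norm (z - c *\<^sub>C w)"
  shows "cinner z w = 0"
proof (cases "w = 0")
  case False
  define a where "a = cinner z w"
  define t where "t = 1 / (norm w)\<^sup>2"
  have tw: "t * (norm w)\<^sup>2 = 1" "t > 0" using False by (auto simp: t_def)
  have "(norm z)\<^sup>2 \<le> (norm (z - (of_real t * a) *\<^sub>C w))\<^sup>2"
    using assms by (simp add: power_mono)
  also have "\<dots> = (norm z)\<^sup>2 - 2 * (t * (cmod a)\<^sup>2) + (t * (norm w)\<^sup>2) * (t * (cmod a)\<^sup>2)"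
  proof -
    have "Re (cinner z ((of_real t * a) *\<^sub>C w)) = t * (cmod a)\<^sup>2"
      unfolding cmod_power2
      by (simp add: cinner_simps a_def[symmetric] power2_eq_square algebra_simps)
    then show ?thesis unfolding norm_diff_square
      by (simp add: norm_scaleC norm_mult power_mult_distrib) (simp add: power2_eq_square)
  qed
  finally have "t * (cmod a)\<^sup>2 \<le> 0" using tw by simp
  then show ?thesis using tw a_def by (simp add: mult_le_0_iff)
qed simp

text \<open>
  The projection theorem, in the form in which it is needed: a vector outside a closed subspace
  minus its best approximation in the subspace would be a nonzero vector orthogonal to the
  subspace.  Minimizing sequences are Cauchy by the parallelogram law.
\<close>

lemma closed_subspace_eq_UNIV:
  fixes V :: "'a::complex_hilbert set"
  assumes cl: "closed V" and zero: "0 \<in> V"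
    and add: "\<And>x y. x \<in> V \<Longrightarrow> y \<in> V \<Longrightarrow> x + y \<in> V"
    and scale: "\<And>c x. x \<in> V \<Longrightarrow> c *\<^sub>C x \<in> V"
    and triv: "\<And>z. (\<And>v. v \<in> V \<Longrightarrow> cinner z v = 0) \<Longrightarrow> z = 0"
  shows "V = UNIV"
proof -
  have "x \<in> V" for x
  proof -
    define d where "d = (INF v\<in>V. (norm (x - v))\<^sup>2)"
    have bdd: "bdd_below ((\<lambda>v. (norm (x - v))\<^sup>2) ` V)" by (rule bdd_belowI2[of _ 0]) simp
    have d_le: "d \<le> (norm (x - v))\<^sup>2" if "v \<in> V" for v
      unfolding d_def using bdd that by (rule cINF_lower)
    have "\<exists>v\<in>V. (norm (x - v))\<^sup>2 < d + 1 / real (Suc n)" for n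
    proof -
      have "d < d + 1 / real (Suc n)" by simp
      then show ?thesis
        using cINF_less_iff[OF _ bdd, of "d + 1 / real (Suc n)"] zero unfolding d_def by blast
    qed
    then obtain s where s: "\<And>n. s n \<in> V" "\<And>n. (norm (x - s n))\<^sup>2 < d + 1 / real (Suc n)"
      by metis
    have close: "(norm (s m - s n))\<^sup>2 < 2 / real (Suc m) + 2 / real (Suc n)" for m n
    proof -
      let ?c = "(1/2) *\<^sub>R (s m + s n)"
      have "?c \<in> V" using add scale s(1) by (simp add: scaleR_scaleC)
      then have "d \<le> (norm (x - ?c))\<^sup>2" by (rule d_le)
      moreover have "(x - s m) + (x - s n) = 2 *\<^sub>R (x - ?c)"
        by (simp add: algebra_simps scaleR_2)
      then have "norm ((x - s m) + (x - s n)) = 2 * norm (x - ?c)" by simp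
      then have "(norm ((x - s m) + (x - s n)))\<^sup>2 = 4 * (norm (x - ?c))\<^sup>2"
        by (simp add: power_mult_distrib)
      moreover have "norm ((x - s m) - (x - s n)) = norm (s m - s n)"
        by (simp add: norm_minus_commute)
      ultimately show ?thesis
        using parallelogram_law[of "x - s m" "x - s n"] s(2)[of m] s(2)[of n] by simp
    qed
    have "Cauchy s"
    proof (rule metric_CauchyI)
      fix e :: real assume e: "e > 0"
      then obtain N where N: "1 / real (Suc N) < e\<^sup>2 / 4"
        using nat_approx_posE[of "e\<^sup>2 / 4"] by auto
      have "dist (s m) (s n) < e" if mn: "m \<ge> N" "n \<ge> N" for m n
      proof -
        have "1 / real (Suc m) \<le> 1 / real (Suc N)" "1 / real (Suc n) \<le> 1 / real (Suc N)"
          using mn by (simp_all add: frac_le)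
        then have "(norm (s m - s n))\<^sup>2 < e\<^sup>2" using close[of m n] N by simp
        then show ?thesis using e by (simp add: dist_norm power_less_imp_less_base)
      qed
      then show "\<exists>M. \<forall>m\<ge>M. \<forall>n\<ge>M. dist (s m) (s n) < e" by blast
    qed
    then obtain v where v: "s \<longlonglongrightarrow> v"
      by (auto simp: Cauchy_convergent_iff convergent_def)
    have vV: "v \<in> V" using closed_sequentially[OF cl _ v] s(1) by blast
    have "(\<lambda>n. d + 1 / real (Suc n)) \<longlonglongrightarrow> d + 0"
      by (intro tendsto_add tendsto_const LIMSEQ_Suc[OF lim_1_over_n])
    moreover have "(\<lambda>n. (norm (x - s n))\<^sup>2) \<longlonglongrightarrow> (norm (x - v))\<^sup>2"
      by (intro tendsto_intros v)
    ultimately have min: "(norm (x - v))\<^sup>2 \<le> d"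
      using s(2) by (intro LIMSEQ_le[of _ _ "\<lambda>n. d + 1 / real (Suc n)"]) (auto intro: less_imp_le)
    have "cinner (x - v) w = 0" if "w \<in> V" for w
    proof (rule orthogonal_if_shortest)
      fix c
      have "v + c *\<^sub>C w \<in> V" using vV that add scale by blast
      then have "(norm (x - v))\<^sup>2 \<le> (norm (x - v - c *\<^sub>C w))\<^sup>2"
        using min d_le[of "v + c *\<^sub>C w"] unfolding diff_diff_eq by linarith
      then show "norm (x - v) \<le> norm (x - v - c *\<^sub>C w)" by (rule power2_le_imp_le) simp
    qed
    then have "x - v = 0" by (rule triv)
    then show ?thesis using vV by simp
  qed
  then show ?thesis by blast
qed


section \<open>Symmetric and self-adjoint operators\<close>

lemma linear_operator_unique:
  "linear_operator A \<Longrightarrow> (f, g) \<in> A \<Longrightarrow> (f, h) \<in> A \<Longrightarrow> g = h"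
  unfolding linear_operator_def single_valued_def by blast

lemma linear_operator_zero: "linear_operator A \<Longrightarrow> (0, 0) \<in> A"
  unfolding linear_operator_def by blast

lemma linear_operator_add:
  "linear_operator A \<Longrightarrow> (f, f') \<in> A \<Longrightarrow> (g, g') \<in> A \<Longrightarrow> (f + g, f' + g') \<in> A"
  unfolding linear_operator_def by blast

lemma linear_operator_scaleC:
  "linear_operator A \<Longrightarrow> (f, f') \<in> A \<Longrightarrow> (c *\<^sub>C f, c *\<^sub>C f') \<in> A"
  unfolding linear_operator_def by blast

lemma linear_operator_diff:
  assumes "linear_operator A" and "(f, f') \<in> A" and "(g, g') \<in> A"
  shows "(f - g, f' - g') \<in> A"
  using linear_operator_add[OF assms(1,2) linear_operator_scaleC[OF assms(1,3), of "- 1"]]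
  by (simp add: scaleC_minus_one)

lemma op_apply_eq: "linear_operator A \<Longrightarrow> (f, g) \<in> A \<Longrightarrow> A \<bullet>\<^sub>o f = g"
  unfolding op_apply_def by (blast intro: linear_operator_unique)

lemma mem_op_restrict_ker: "(f, g) \<in> A \<restriction>\<^sub>o op_ker \<Gamma> \<longleftrightarrow> (f, g) \<in> A \<and> (f, 0) \<in> \<Gamma>"
  by (auto simp: op_restrict_def op_ker_def)

lemma mem_op_diff_scalar: "(f, g) \<in> A -\<^sub>o scalar_op \<mu> \<longleftrightarrow> (f, g + \<mu> *\<^sub>C f) \<in> A"
proof -
  have "(f, g) \<in> A -\<^sub>o scalar_op \<mu>" if "(f, g + \<mu> *\<^sub>C f) \<in> A"
    unfolding op_diff_def scalar_op_def using that
    by (auto intro!: exI[of _ "g + \<mu> *\<^sub>C f"])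
  then show ?thesis by (auto simp: op_diff_def scalar_op_def)
qed

lemma surj_op_diff_scalarE:
  assumes "Range (A -\<^sub>o scalar_op \<mu>) = UNIV"
  obtains f where "(f, h + \<mu> *\<^sub>C f) \<in> A"
  using assms mem_op_diff_scalar by (metis Range_iff UNIV_I)

lemma mem_op_adjoint:
  "(g, g') \<in> A\<^sup>*\<^sub>o \<longleftrightarrow> (\<forall>f f'. (f, f') \<in> A \<longrightarrow> cinner f' g = cinner f g')"
  by (auto simp: op_adjoint_def)

lemma op_adjoint_diff:
  "(f, f') \<in> A\<^sup>*\<^sub>o \<Longrightarrow> (g, g') \<in> A\<^sup>*\<^sub>o \<Longrightarrow> (f - g, f' - g') \<in> A\<^sup>*\<^sub>o"
  by (simp add: mem_op_adjoint cinner_simps)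

lemma closed_op_adjoint:
  fixes A :: "('a::complex_hilbert \<times> 'b::complex_hilbert) set"
  shows "closed (A\<^sup>*\<^sub>o)"
proof -
  have "A\<^sup>*\<^sub>o = (\<Inter>(f, f')\<in>A. {p. cinner f' (fst p) = cinner f (snd p)})"
    by (auto simp: op_adjoint_def)
  moreover have "closed {p. cinner f' (fst p) = cinner f (snd p)}" for f :: 'a and f' :: 'b
    by (intro closed_Collect_eq continuous_intros)
  ultimately show ?thesis by auto
qed

lemma self_adjoint_symmetric:
  assumes "self_adjoint A" and "(f, f') \<in> A" and "(g, g') \<in> A"
  shows "cinner f' g = cinner f g'"
  using assms unfolding self_adjoint_def by (metis mem_op_adjoint)

text \<open>
  The real part of \<open>\<mu>\<close> only shifts \<open>A\<close>, and the two summands of \<open>(A - Re \<mu>) f - \<i> (Im \<mu>) f\<close> are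
  orthogonal in the real sense because \<open>((A - Re \<mu>) f, f)\<close> is real.
\<close>

lemma symmetric_lower_bound:
  fixes f f' :: "'a::complex_hilbert"
  assumes sym: "cinner f' f = cinner f f'"
  shows "\<bar>Im \<mu>\<bar> * norm f \<le> norm (f' - \<mu> *\<^sub>C f)"
proof -
  define u where "u = f' - complex_of_real (Re \<mu>) *\<^sub>C f"
  have split: "f' - \<mu> *\<^sub>C f = u - (\<i> * of_real (Im \<mu>)) *\<^sub>C f"
    by (simp add: u_def diff_diff_eq scaleC_add_left[symmetric] complex_eq[symmetric])
  have "cinner u f = cinner f u" using sym by (simp add: u_def cinner_simps)
  then have "Im (cinner u f) = 0"
    by (metis cnj_cinner Reals_cnj_iff complex_is_Real_iff)
  then have "(norm (f' - \<mu> *\<^sub>C f))\<^sup>2 = (norm u)\<^sup>2 + (\<bar>Im \<mu>\<bar> * norm f)\<^sup>2"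
    unfolding split norm_diff_square
    by (simp add: cinner_simps norm_scaleC norm_mult)
  then have "(\<bar>Im \<mu>\<bar> * norm f)\<^sup>2 \<le> (norm (f' - \<mu> *\<^sub>C f))\<^sup>2" by simp
  then show ?thesis by (rule power2_le_imp_le) simp
qed

text \<open>
  The basic criterion in one direction.  The range of \<open>A - \<mu>\<close> is closed because \<open>A\<close> is closed and
  \<open>A - \<mu>\<close> is bounded below; a vector orthogonal to it is an eigenvector of \<open>A\<^sup>*\<^sub>o = A\<close> for the
  nonreal eigenvalue \<open>cnj \<mu>\<close>, hence zero by the same lower bound.
\<close>

lemma self_adjoint_surj:
  fixes A :: "('a::complex_hilbert \<times> 'a) set"
  assumes sa: "self_adjoint A" and im: "Im \<mu> \<noteq> 0"
  shows "Range (A -\<^sub>o scalar_op \<mu>) = UNIV"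
proof (rule closed_subspace_eq_UNIV)
  let ?V = "Range (A -\<^sub>o scalar_op \<mu>)"
  have lin: "linear_operator A" and adj: "A\<^sup>*\<^sub>o = A"
    using sa by (auto simp: self_adjoint_def)
  have clA: "closed A" using closed_op_adjoint[of A] adj by simp
  have V: "h \<in> ?V \<longleftrightarrow> (\<exists>f. (f, h + \<mu> *\<^sub>C f) \<in> A)" for h
    by (auto simp: mem_op_diff_scalar Range_iff)
  have bound: "\<bar>Im \<mu>\<bar> * norm f \<le> norm h" if "(f, h + \<mu> *\<^sub>C f) \<in> A" for f h
    using symmetric_lower_bound[OF self_adjoint_symmetric[OF sa that that], of \<mu>] by simp
  show "closed ?V"
    unfolding closed_sequential_limits
  proof (intro allI impI)
    fix h l assume "(\<forall>n. h n \<in> ?V) \<and> h \<longlonglongrightarrow> l"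
    then have hl: "h \<longlonglongrightarrow> l" and "\<forall>n. \<exists>f. (f, h n + \<mu> *\<^sub>C f) \<in> A" by (auto simp: V)
    then obtain f where f: "\<And>n. (f n, h n + \<mu> *\<^sub>C f n) \<in> A" by metis
    have "Cauchy f"
    proof (rule metric_CauchyI)
      fix e :: real assume e: "e > 0"
      have "Cauchy h" using hl LIMSEQ_imp_Cauchy by blast
      then obtain N where N: "\<And>m n. m \<ge> N \<Longrightarrow> n \<ge> N \<Longrightarrow> dist (h m) (h n) < \<bar>Im \<mu>\<bar> * e"
        using e im metric_CauchyD[of h "\<bar>Im \<mu>\<bar> * e"] by auto
      have "dist (f m) (f n) < e" if "m \<ge> N" "n \<ge> N" for m n
      proof -
        have "(f m - f n, (h m - h n) + \<mu> *\<^sub>C (f m - f n)) \<in> A"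
          using linear_operator_diff[OF lin f[of m] f[of n]]
          by (simp add: scaleC_diff_right algebra_simps)
        then have "\<bar>Im \<mu>\<bar> * norm (f m - f n) < \<bar>Im \<mu>\<bar> * e"
          using bound N[OF that] unfolding dist_norm by (meson le_less_trans)
        then show ?thesis using im by (simp add: dist_norm)
      qed
      then show "\<exists>M. \<forall>m\<ge>M. \<forall>n\<ge>M. dist (f m) (f n) < e" by blast
    qed
    then obtain g where g: "f \<longlonglongrightarrow> g" by (auto simp: Cauchy_convergent_iff convergent_def)
    have "(\<lambda>n. (f n, h n + \<mu> *\<^sub>C f n)) \<longlonglongrightarrow> (g, l + \<mu> *\<^sub>C g)"
      by (intro tendsto_intros tendsto_scaleC g hl)
    then have "(g, l + \<mu> *\<^sub>C g) \<in> A" by (rule closed_sequentially[OF clA f])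
    then show "l \<in> ?V" using V by blast
  qed
  show "0 \<in> ?V" using linear_operator_zero[OF lin] unfolding V by (intro exI[of _ 0]) simp
  show "x + y \<in> ?V" if xy: "x \<in> ?V" "y \<in> ?V" for x y
  proof -
    obtain f g where fg: "(f, x + \<mu> *\<^sub>C f) \<in> A" "(g, y + \<mu> *\<^sub>C g) \<in> A" using xy V by metis
    have "(f + g, (x + y) + \<mu> *\<^sub>C (f + g)) \<in> A"
      using linear_operator_add[OF lin fg] by (simp add: scaleC_add_right algebra_simps)
    then show ?thesis using V by blast
  qed
  show "c *\<^sub>C x \<in> ?V" if x: "x \<in> ?V" for c x
  proof -
    obtain f where f: "(f, x + \<mu> *\<^sub>C f) \<in> A" using x V by metis
    have "(c *\<^sub>C f, c *\<^sub>C x + \<mu> *\<^sub>C (c *\<^sub>C f)) \<in> A"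
      using linear_operator_scaleC[OF lin f, of c]
      by (simp add: scaleC_add_right scaleC_scaleC mult.commute)
    then show ?thesis using V by blast
  qed
  show "z = 0" if z: "\<And>v. v \<in> ?V \<Longrightarrow> cinner z v = 0" for z
  proof -
    have "(z, cnj \<mu> *\<^sub>C z) \<in> A\<^sup>*\<^sub>o"
      unfolding mem_op_adjoint
    proof (intro allI impI)
      fix f f' assume "(f, f') \<in> A"
      then have "f' - \<mu> *\<^sub>C f \<in> ?V" using V by (metis diff_add_cancel)
      then have "cinner (f' - \<mu> *\<^sub>C f) z = 0"
        using z by (metis cnj_cinner complex_cnj_zero)
      then show "cinner f' z = cinner f (cnj \<mu> *\<^sub>C z)" by (simp add: cinner_simps)
    qed
    then have "cinner (cnj \<mu> *\<^sub>C z) z = cinner z (cnj \<mu> *\<^sub>C z)"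
      using adj self_adjoint_symmetric[OF sa] by simp
    from symmetric_lower_bound[OF this, of "cnj \<mu>"] show ?thesis
      using im by (simp add: mult_le_0_iff)
  qed
qed

text \<open>
  The points \<open>\<mu>\<^sub>p\<close> and \<open>\<mu>\<^sub>m\<close> need not be conjugate to each other, so that the kernel of
  \<open>A\<^sup>*\<^sub>o - \<mu>\<^sub>p\<close> is not immediately the orthogonal complement of a full range.  Instead, surjectivity
  at \<open>\<mu>\<close> splits off from every element of \<open>A\<^sup>*\<^sub>o\<close> one of \<open>A\<close> and leaves an eigenvector for
  \<open>\<mu>\<close>.  The boundary form \<open>(A\<^sup>*\<^sub>o u, v) - (u, A\<^sup>*\<^sub>o v)\<close> ignores the part in \<open>A\<close>;
  comparing its values for an eigenvector \<open>g\<close> at \<open>\<mu>\<^sub>p\<close>, which is \<open>2 \<i> (Im \<mu>\<^sub>p) \<parallel>g\<parallel>\<^sup>2\<close>, and for the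
  eigenvector \<open>h\<close> at \<open>\<mu>\<^sub>m\<close> that \<open>g\<close> leaves behind, opposite signs force both to vanish.
\<close>

lemma symmetric_surj_imp_adjoint_eq:
  fixes A :: "('a::complex_hilbert \<times> 'a) set"
  assumes sym: "symmetric_operator A"
    and p: "Range (A -\<^sub>o scalar_op \<mu>\<^sub>p) = UNIV" "Im \<mu>\<^sub>p > 0"
    and m: "Range (A -\<^sub>o scalar_op \<mu>\<^sub>m) = UNIV" "Im \<mu>\<^sub>m < 0"
  shows "A\<^sup>*\<^sub>o = A"
proof
  show sub: "A \<subseteq> A\<^sup>*\<^sub>o"
    using sym by (fastforce simp: symmetric_operator_def op_adjoint_def)
  have split: "\<exists>f f'. (f, f') \<in> A \<and> (g - f, \<mu> *\<^sub>C (g - f)) \<in> A\<^sup>*\<^sub>o \<and> g' - f' = \<mu> *\<^sub>C (g - f)"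
    if surj: "Range (A -\<^sub>o scalar_op \<mu>) = UNIV" and g: "(g, g') \<in> A\<^sup>*\<^sub>o" for \<mu> g g'
  proof -
    obtain f where f: "(f, (g' - \<mu> *\<^sub>C g) + \<mu> *\<^sub>C f) \<in> A" using surj by (rule surj_op_diff_scalarE)
    have eq: "g' - ((g' - \<mu> *\<^sub>C g) + \<mu> *\<^sub>C f) = \<mu> *\<^sub>C (g - f)" by (simp add: scaleC_diff_right)
    then show ?thesis using f op_adjoint_diff[OF g subsetD[OF sub f]] by metis
  qed
  have eigen: "cinner (\<mu> *\<^sub>C u) u - cinner u (\<mu> *\<^sub>C u) = 2 * \<i> * of_real (Im \<mu> * (norm u)\<^sup>2)"
    for \<mu> and u :: 'a
  proof -
    have "cinner (\<mu> *\<^sub>C u) u - cinner u (\<mu> *\<^sub>C u) = (\<mu> - cnj \<mu>) * cinner u u"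
      by (simp add: cinner_simps algebra_simps)
    then show ?thesis by (simp add: complex_diff_cnj cinner_norm)
  qed
  have null: "g = 0" if g: "(g, \<mu>\<^sub>p *\<^sub>C g) \<in> A\<^sup>*\<^sub>o" for g
  proof -
    obtain f f' where f: "(f, f') \<in> A" "(g - f, \<mu>\<^sub>m *\<^sub>C (g - f)) \<in> A\<^sup>*\<^sub>o"
      "\<mu>\<^sub>p *\<^sub>C g - f' = \<mu>\<^sub>m *\<^sub>C (g - f)" using split[OF m(1) g] by blast
    define h where "h = g - f"
    have gf: "g = f + h" "\<mu>\<^sub>p *\<^sub>C g = f' + \<mu>\<^sub>m *\<^sub>C h"
      using f(3) by (auto simp: h_def algebra_simps)
    have fh: "cinner f' h = cinner f (\<mu>\<^sub>m *\<^sub>C h)" and ff: "cinner f' f = cinner f f'"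
      using f sub by (auto simp: mem_op_adjoint h_def)
    have hf: "cinner (\<mu>\<^sub>m *\<^sub>C h) f = cinner h f'"
      using arg_cong[OF fh, of cnj] by simp
    have "cinner (\<mu>\<^sub>p *\<^sub>C g) g - cinner g (\<mu>\<^sub>p *\<^sub>C g) =
        cinner (\<mu>\<^sub>m *\<^sub>C h) h - cinner h (\<mu>\<^sub>m *\<^sub>C h)"
      unfolding gf(2) unfolding gf(1) cinner_add_left cinner_add_right fh ff hf by simp
    then have "complex_of_real (Im \<mu>\<^sub>p * (norm g)\<^sup>2) = complex_of_real (Im \<mu>\<^sub>m * (norm h)\<^sup>2)"
      unfolding eigen by simp
    then have "Im \<mu>\<^sub>p * (norm g)\<^sup>2 = Im \<mu>\<^sub>m * (norm h)\<^sup>2" by (simp only: of_real_eq_iff)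
    also have "\<dots> \<le> 0" using m(2) by (simp add: mult_nonpos_nonneg)
    finally show ?thesis using p(2) by (simp add: mult_le_0_iff)
  qed
  show "A\<^sup>*\<^sub>o \<subseteq> A"
  proof
    fix x assume "x \<in> A\<^sup>*\<^sub>o"
    then obtain g g' where g: "x = (g, g')" "(g, g') \<in> A\<^sup>*\<^sub>o" by (cases x) auto
    obtain f f' where f: "(f, f') \<in> A" "(g - f, \<mu>\<^sub>p *\<^sub>C (g - f)) \<in> A\<^sup>*\<^sub>o"
      "g' - f' = \<mu>\<^sub>p *\<^sub>C (g - f)" using split[OF p(1) g(2)] by blast
    have "g - f = 0" using null[OF f(2)] .
    then show "x \<in> A" using f g by simp
  qed
qed


section \<open>Quasi boundary triples\<close>

lemma mem_gamma_field:
  "(\<phi>, f) \<in> gamma_field T \<Gamma>\<^sub>0 \<mu> \<longleftrightarrow> (f, \<mu> *\<^sub>C f) \<in> T \<and> (f, \<phi>) \<in> \<Gamma>\<^sub>0"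
  by (auto simp: gamma_field_def mem_op_restrict_ker mem_op_diff_scalar op_restrict_def op_ker_def)

lemma mem_weyl_function:
  "(\<phi>, \<psi>) \<in> weyl_function T \<Gamma>\<^sub>0 \<Gamma>\<^sub>1 \<mu> \<longleftrightarrow>
     (\<exists>f. (f, \<mu> *\<^sub>C f) \<in> T \<and> (f, \<phi>) \<in> \<Gamma>\<^sub>0 \<and> (f, \<psi>) \<in> \<Gamma>\<^sub>1)"
  by (auto simp: weyl_function_def op_mult_def relcomp_unfold mem_gamma_field)

text \<open>
  For both boundary maps \<open>\<Gamma>\<close> of a triple this gives \<open>dom T = ker \<Gamma> + ker (T - \<mu>)\<close> as soon as
  \<open>T\<close> restricted to \<open>ker \<Gamma>\<close>, shifted by \<open>\<mu>\<close>, is surjective.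
\<close>

lemma ker_decomposition:
  assumes lin: "linear_operator T"
    and surj: "Range (T \<restriction>\<^sub>o op_ker \<Gamma> -\<^sub>o scalar_op \<mu>) = UNIV" and f: "(f, f') \<in> T"
  obtains k where "(k, 0) \<in> \<Gamma>" and "(f - k, \<mu> *\<^sub>C (f - k)) \<in> T"
proof -
  obtain k where k: "(k, (f' - \<mu> *\<^sub>C f) + \<mu> *\<^sub>C k) \<in> T \<restriction>\<^sub>o op_ker \<Gamma>"
    using surj by (rule surj_op_diff_scalarE)
  then have "(f - k, f' - ((f' - \<mu> *\<^sub>C f) + \<mu> *\<^sub>C k)) \<in> T"
    using linear_operator_diff[OF lin f] unfolding mem_op_restrict_ker by blast
  then have "(f - k, \<mu> *\<^sub>C (f - k)) \<in> T" by (simp add: scaleC_diff_right)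
  with k show thesis by (intro that) (simp_all add: mem_op_restrict_ker)
qed

locale boundary_triple =
  fixes S T :: "('h::complex_hilbert \<times> 'h) set"
    and \<Gamma>\<^sub>0 \<Gamma>\<^sub>1 :: "('h \<times> 'g::complex_hilbert) set"
  assumes triple: "quasi_boundary_triple S T \<Gamma>\<^sub>0 \<Gamma>\<^sub>1"
begin

abbreviation "A\<^sub>0 \<equiv> T \<restriction>\<^sub>o op_ker \<Gamma>\<^sub>0"
abbreviation "A\<^sub>1 \<equiv> T \<restriction>\<^sub>o op_ker \<Gamma>\<^sub>1"
abbreviation "\<gamma> \<equiv> gamma_field T \<Gamma>\<^sub>0"
abbreviation "M \<equiv> weyl_function T \<Gamma>\<^sub>0 \<Gamma>\<^sub>1"

lemma lin: "linear_operator T" "linear_operator \<Gamma>\<^sub>0" "linear_operator \<Gamma>\<^sub>1"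
  using triple by (auto simp: quasi_boundary_triple_def)

lemma self_adjoint_A0: "self_adjoint A\<^sub>0"
  using triple by (auto simp: quasi_boundary_triple_def)

lemma boundary_values:
  assumes "(f, f') \<in> T"
  obtains a b where "(f, a) \<in> \<Gamma>\<^sub>0" and "(f, b) \<in> \<Gamma>\<^sub>1"
  using triple assms by (auto simp: quasi_boundary_triple_def) (metis DomainE DomainI)

lemma in_domain: "(f, a) \<in> \<Gamma>\<^sub>0 \<Longrightarrow> \<exists>f'. (f, f') \<in> T" "(f, b) \<in> \<Gamma>\<^sub>1 \<Longrightarrow> \<exists>f'. (f, f') \<in> T"
  using triple by (auto simp: quasi_boundary_triple_def)

lemma green:
  assumes "(f, f') \<in> T" and "(g, g') \<in> T"
    and "(f, a) \<in> \<Gamma>\<^sub>0" and "(f, b) \<in> \<Gamma>\<^sub>1" and "(g, c) \<in> \<Gamma>\<^sub>0" and "(g, d) \<in> \<Gamma>\<^sub>1"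
  shows "cinner f' g - cinner f g' = cinner b c - cinner a d"
proof -
  have "cinner (T \<bullet>\<^sub>o f) g - cinner f (T \<bullet>\<^sub>o g) =
      cinner (\<Gamma>\<^sub>1 \<bullet>\<^sub>o f) (\<Gamma>\<^sub>0 \<bullet>\<^sub>o g) - cinner (\<Gamma>\<^sub>0 \<bullet>\<^sub>o f) (\<Gamma>\<^sub>1 \<bullet>\<^sub>o g)"
    using triple assms(1,2) unfolding quasi_boundary_triple_def by blast
  then show ?thesis using assms lin by (simp add: op_apply_eq)
qed

text \<open>
  How the density of the range of \<open>(\<Gamma>\<^sub>0, \<Gamma>\<^sub>1)\<close> enters: by continuity, an identity that is tested
  against all boundary values can be tested against \<open>(b, - a)\<close>.
\<close>

lemma boundary_nondegenerate:
  assumes "\<And>f c d. (f, c) \<in> \<Gamma>\<^sub>0 \<Longrightarrow> (f, d) \<in> \<Gamma>\<^sub>1 \<Longrightarrow> cinner b c = cinner a d"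
  shows "a = 0" and "b = 0"
proof -
  let ?R = "{(\<Gamma>\<^sub>0 \<bullet>\<^sub>o f, \<Gamma>\<^sub>1 \<bullet>\<^sub>o f) | f. f \<in> Domain T}"
  let ?E = "{p. cinner b (fst p) = cinner a (snd p)}"
  have "?R \<subseteq> ?E"
  proof clarsimp
    fix f f' assume "(f, f') \<in> T"
    then obtain c d where "(f, c) \<in> \<Gamma>\<^sub>0" "(f, d) \<in> \<Gamma>\<^sub>1" by (rule boundary_values)
    then show "cinner b (\<Gamma>\<^sub>0 \<bullet>\<^sub>o f) = cinner a (\<Gamma>\<^sub>1 \<bullet>\<^sub>o f)"
      using assms lin by (simp add: op_apply_eq)
  qed
  moreover have "closed ?E" by (intro closed_Collect_eq continuous_intros)
  ultimately have "closure ?R \<subseteq> ?E" by (rule closure_minimal)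
  moreover have "closure ?R = UNIV" using triple unfolding quasi_boundary_triple_def by blast
  ultimately have all: "?E = UNIV" by blast
  have E: "cinner b c = cinner a d" for c d
  proof -
    have "(c, d) \<in> ?E" unfolding all by (rule UNIV_I)
    then show ?thesis by simp
  qed
  show "a = 0" by (rule cinner_self_eq_0) (use E[of 0 a] in simp)
  show "b = 0" by (rule cinner_self_eq_0) (use E[of b 0] in simp)
qed

lemma range_\<Gamma>0_total:
  assumes "\<And>c. c \<in> Range \<Gamma>\<^sub>0 \<Longrightarrow> cinner b c = 0"
  shows "b = 0"
  using assms by (intro boundary_nondegenerate(2)[of b 0]) (auto simp: Range_iff)

lemma surj_A0_cnj:
  assumes "Range (A\<^sub>0 -\<^sub>o scalar_op \<mu>) = UNIV"
  shows "Range (A\<^sub>0 -\<^sub>o scalar_op (cnj \<mu>)) = UNIV"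
proof (cases "Im \<mu> = 0")
  case True
  then have "cnj \<mu> = \<mu>" by (simp add: complex_eq_iff)
  then show ?thesis using assms by simp
next
  case False
  then show ?thesis by (intro self_adjoint_surj self_adjoint_A0) simp
qed

lemma eigenvector_with_boundary_value:
  assumes surj: "Range (A\<^sub>0 -\<^sub>o scalar_op \<mu>) = UNIV" and "\<phi> \<in> Range \<Gamma>\<^sub>0"
  obtains f where "(f, \<mu> *\<^sub>C f) \<in> T" and "(f, \<phi>) \<in> \<Gamma>\<^sub>0"
proof -
  obtain g g' where g: "(g, \<phi>) \<in> \<Gamma>\<^sub>0" "(g, g') \<in> T" using assms(2) in_domain by blast
  obtain k where k: "(k, 0) \<in> \<Gamma>\<^sub>0" "(g - k, \<mu> *\<^sub>C (g - k)) \<in> T"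
    using ker_decomposition[OF lin(1) surj g(2)] .
  then show thesis using linear_operator_diff[OF lin(2) g(1) k(1)] that by simp
qed

text \<open>Green's identity makes the boundary form vanish on eigenvectors for conjugate eigenvalues.\<close>

lemma weyl_function_cnj: "M \<mu> \<subseteq> (M (cnj \<mu>))\<^sup>*\<^sub>o"
proof clarify
  fix \<phi> \<psi> assume "(\<phi>, \<psi>) \<in> M \<mu>"
  then obtain f where f: "(f, \<mu> *\<^sub>C f) \<in> T" "(f, \<phi>) \<in> \<Gamma>\<^sub>0" "(f, \<psi>) \<in> \<Gamma>\<^sub>1"
    by (auto simp: mem_weyl_function)
  show "(\<phi>, \<psi>) \<in> (M (cnj \<mu>))\<^sup>*\<^sub>o"
    unfolding mem_op_adjoint
  proof (intro allI impI)
    fix c d assume "(c, d) \<in> M (cnj \<mu>)"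
    then obtain g where g: "(g, cnj \<mu> *\<^sub>C g) \<in> T" "(g, c) \<in> \<Gamma>\<^sub>0" "(g, d) \<in> \<Gamma>\<^sub>1"
      by (auto simp: mem_weyl_function)
    show "cinner d \<phi> = cinner c \<psi>"
      using green[OF g(1) f(1) g(2,3) f(2,3)] by (simp add: cinner_simps)
  qed
qed

text \<open>
  So \<open>M(\<mu>)\<close> is closable: the closed relation \<open>M(cnj \<mu>)\<^sup>*\<^sub>o\<close> above it is single-valued, because the
  domain of \<open>M(cnj \<mu>)\<close> is all of the range of \<open>\<Gamma>\<^sub>0\<close>.
\<close>

lemma closure_weyl_function_unique:
  assumes surj: "Range (A\<^sub>0 -\<^sub>o scalar_op \<mu>) = UNIV"
    and 1: "(\<phi>, \<psi>) \<in> closure (M \<mu>)" and 2: "(\<phi>, \<psi>') \<in> closure (M \<mu>)"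
  shows "\<psi> = \<psi>'"
proof -
  have "closure (M \<mu>) \<subseteq> (M (cnj \<mu>))\<^sup>*\<^sub>o"
    by (intro closure_minimal weyl_function_cnj closed_op_adjoint)
  with 1 2 have adj: "(\<phi>, \<psi>) \<in> (M (cnj \<mu>))\<^sup>*\<^sub>o" "(\<phi>, \<psi>') \<in> (M (cnj \<mu>))\<^sup>*\<^sub>o" by auto
  have "\<psi> - \<psi>' = 0"
  proof (rule range_\<Gamma>0_total)
    fix c assume "c \<in> Range \<Gamma>\<^sub>0"
    then obtain g where g: "(g, cnj \<mu> *\<^sub>C g) \<in> T" "(g, c) \<in> \<Gamma>\<^sub>0"
      using eigenvector_with_boundary_value[OF surj_A0_cnj[OF surj]] by blast
    obtain d where d: "(g, d) \<in> \<Gamma>\<^sub>1" using boundary_values[OF g(1)] .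
    have "(c, d) \<in> M (cnj \<mu>)" using g d by (auto simp: mem_weyl_function)
    then have "cinner c \<psi> = cinner c \<psi>'" using adj unfolding mem_op_adjoint by metis
    then have "cinner c (\<psi> - \<psi>') = 0" by (simp add: cinner_simps)
    then show "cinner (\<psi> - \<psi>') c = 0" by (metis cnj_cinner complex_cnj_zero)
  qed
  then show ?thesis by simp
qed

text \<open>
  The adjoint of \<open>\<gamma> (cnj \<mu>)\<close> is \<open>\<Gamma>\<^sub>1 (A\<^sub>0 - \<mu>)\<inverse>\<close>, by Green's identity for an element of the
  domain of \<open>A\<^sub>0\<close> and an eigenvector; it is single-valued because the range of \<open>\<Gamma>\<^sub>0\<close> is dense.
\<close>

lemma adjoint_gamma_field:
  assumes surj: "Range (A\<^sub>0 -\<^sub>o scalar_op \<mu>) = UNIV"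
    and k: "(k, h + \<mu> *\<^sub>C k) \<in> A\<^sub>0" and b: "(k, b) \<in> \<Gamma>\<^sub>1"
  shows "(h, c) \<in> (\<gamma> (cnj \<mu>))\<^sup>*\<^sub>o \<longleftrightarrow> c = b"
proof -
  have kT: "(k, h + \<mu> *\<^sub>C k) \<in> T" "(k, 0) \<in> \<Gamma>\<^sub>0" using k by (auto simp: mem_op_restrict_ker)
  have pair: "cinner g h = cinner \<phi> b"
    if g: "(g, cnj \<mu> *\<^sub>C g) \<in> T" "(g, \<phi>) \<in> \<Gamma>\<^sub>0" for g \<phi>
  proof -
    obtain d where d: "(g, d) \<in> \<Gamma>\<^sub>1" using boundary_values[OF g(1)] .
    show ?thesis using green[OF g(1) kT(1) g(2) d kT(2) b] by (simp add: cinner_simps)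
  qed
  show ?thesis
  proof
    assume c: "(h, c) \<in> (\<gamma> (cnj \<mu>))\<^sup>*\<^sub>o"
    have "c - b = 0"
    proof (rule range_\<Gamma>0_total)
      fix \<phi> assume "\<phi> \<in> Range \<Gamma>\<^sub>0"
      then obtain g where g: "(g, cnj \<mu> *\<^sub>C g) \<in> T" "(g, \<phi>) \<in> \<Gamma>\<^sub>0"
        using eigenvector_with_boundary_value[OF surj_A0_cnj[OF surj]] by blast
      then have "cinner \<phi> (c - b) = 0"
        using c pair[OF g] by (auto simp: mem_op_adjoint mem_gamma_field cinner_simps)
      then show "cinner (c - b) \<phi> = 0" by (metis cnj_cinner complex_cnj_zero)
    qed
    then show "c = b" by simp
  next
    assume "c = b"
    then show "(h, c) \<in> (\<gamma> (cnj \<mu>))\<^sup>*\<^sub>o" by (auto simp: mem_op_adjoint mem_gamma_field pair)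
  qed
qed

text \<open>
  Since \<open>S \<subseteq> T\<^sup>*\<^sub>o \<subseteq> A\<^sub>0\<^sup>*\<^sub>o = A\<^sub>0\<close>, elements of the domain of \<open>S\<close> lie in that of \<open>T\<close>, and
  their boundary values annihilate all others under Green's identity.
\<close>

lemma minimal_operator:
  assumes "(f, f') \<in> S"
  shows "(f, f') \<in> T" and "(f, 0) \<in> \<Gamma>\<^sub>0" and "(f, 0) \<in> \<Gamma>\<^sub>1"
proof -
  have "T \<subseteq> S\<^sup>*\<^sub>o" using triple unfolding quasi_boundary_triple_def by blast
  then have ST: "cinner f' g = cinner f g'" if "(g, g') \<in> T" for g g'
    using that assms by (auto simp: mem_op_adjoint)
  then have "(f, f') \<in> A\<^sub>0\<^sup>*\<^sub>o"
    by (auto simp: mem_op_adjoint mem_op_restrict_ker) (metis cnj_cinner)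
  then have "(f, f') \<in> A\<^sub>0" using self_adjoint_A0 by (simp add: self_adjoint_def)
  then show f: "(f, f') \<in> T" "(f, 0) \<in> \<Gamma>\<^sub>0" by (auto simp: mem_op_restrict_ker)
  obtain b where b: "(f, b) \<in> \<Gamma>\<^sub>1" using boundary_values[OF f(1)] .
  have "cinner b c = cinner 0 d" if cd: "(g, c) \<in> \<Gamma>\<^sub>0" "(g, d) \<in> \<Gamma>\<^sub>1" for g c d
  proof -
    obtain g' where "(g, g') \<in> T" using in_domain(1)[OF cd(1)] by blast
    then show ?thesis using green[OF f(1) _ f(2) b cd] ST by auto
  qed
  then have "b = 0" by (rule boundary_nondegenerate(2))
  then show "(f, 0) \<in> \<Gamma>\<^sub>1" using b by simp
qed

end


section \<open>Boundary conditions with a self-adjoint parameter\<close>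

locale boundary_parameter = boundary_triple S T \<Gamma>\<^sub>0 \<Gamma>\<^sub>1
  for S T :: "('h::complex_hilbert \<times> 'h) set"
    and \<Gamma>\<^sub>0 \<Gamma>\<^sub>1 :: "('h \<times> 'g::complex_hilbert) set" +
  fixes B :: "('g \<times> 'g) set"
  assumes self_adjoint_B: "self_adjoint B" and domain_B: "Domain B = UNIV"
begin

abbreviation "A\<^sub>B \<equiv> boundary_extension T \<Gamma>\<^sub>0 \<Gamma>\<^sub>1 B"

lemma lin_B: "linear_operator B"
  using self_adjoint_B by (simp add: self_adjoint_def)

lemma mem_boundary_extension:
  "(f, f') \<in> A\<^sub>B \<longleftrightarrow> (f, f') \<in> T \<and> (\<exists>a b. (f, a) \<in> \<Gamma>\<^sub>0 \<and> (f, b) \<in> \<Gamma>\<^sub>1 \<and> (b, a) \<in> B)"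
proof (cases "(f, f') \<in> T")
  case True
  then obtain a b where ab: "(f, a) \<in> \<Gamma>\<^sub>0" "(f, b) \<in> \<Gamma>\<^sub>1" by (rule boundary_values)
  obtain c where c: "(b, c) \<in> B" using domain_B by blast
  have "(f, f') \<in> A\<^sub>B \<longleftrightarrow> a = c"
    using True ab c lin lin_B by (auto simp: boundary_extension_def op_restrict_def op_apply_eq)
  then show ?thesis
    using True ab c lin lin_B by (metis linear_operator_unique)
qed (auto simp: boundary_extension_def op_restrict_def)

lemma linear_boundary_extension: "linear_operator A\<^sub>B"
  unfolding linear_operator_def
proof (intro conjI allI impI)
  show "single_valued A\<^sub>B"
    using linear_operator_unique[OF lin(1)] by (auto simp: single_valued_def mem_boundary_extension)
  show "(0, 0) \<in> A\<^sub>B"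
    unfolding mem_boundary_extension
    by (intro conjI exI[of _ 0] linear_operator_zero lin lin_B)
  show "(f + g, f' + g') \<in> A\<^sub>B" if "(f, f') \<in> A\<^sub>B" "(g, g') \<in> A\<^sub>B" for f f' g g'
    using that linear_operator_add lin lin_B unfolding mem_boundary_extension by meson
  show "(c *\<^sub>C f, c *\<^sub>C f') \<in> A\<^sub>B" if "(f, f') \<in> A\<^sub>B" for c f f'
    using that linear_operator_scaleC lin lin_B unfolding mem_boundary_extension by meson
qed

lemma symmetric_boundary_extension: "symmetric_operator A\<^sub>B"
  unfolding symmetric_operator_def
proof clarify
  fix f f' g g' assume "(f, f') \<in> A\<^sub>B" "(g, g') \<in> A\<^sub>B"
  then obtain a b c d where *: "(f, f') \<in> T" "(g, g') \<in> T" "(f, a) \<in> \<Gamma>\<^sub>0" "(f, b) \<in> \<Gamma>\<^sub>1"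
    "(g, c) \<in> \<Gamma>\<^sub>0" "(g, d) \<in> \<Gamma>\<^sub>1" and B: "(b, a) \<in> B" "(d, c) \<in> B"
    by (auto simp: mem_boundary_extension)
  show "cinner f' g = cinner f g'"
    using green[OF *] self_adjoint_symmetric[OF self_adjoint_B B] by simp
qed

lemma extends_minimal_operator: "S \<subseteq> A\<^sub>B"
proof clarify
  fix f f' assume "(f, f') \<in> S"
  from minimal_operator[OF this] show "(f, f') \<in> A\<^sub>B"
    using linear_operator_zero[OF lin_B] unfolding mem_boundary_extension by blast
qed

text \<open>
  Solving \<open>(A\<^sub>B - \<mu>) f = h\<close>: with \<open>k = (A\<^sub>0 - \<mu>)\<inverse> h\<close> and \<open>f = k + \<gamma>(\<mu>) \<phi>\<close>, the boundary
  condition becomes \<open>\<phi> - B M(\<mu>) \<phi> = B \<Gamma>\<^sub>1 k\<close>.  The hypothesis on \<open>B\<close> and \<open>M(\<mu>)\<close> provides a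
  solution \<open>\<phi>\<close> only with the closure of \<open>M(\<mu>)\<close>; but then \<open>\<phi>\<close> is a sum of two elements of the
  range of \<open>\<Gamma>\<^sub>0\<close>, which is the domain of \<open>M(\<mu>)\<close>, where the closure agrees with \<open>M(\<mu>)\<close>.
\<close>

lemma boundary_extension_surj:
  assumes surj0: "Range (A\<^sub>0 -\<^sub>o scalar_op \<mu>) = UNIV"
    and surjM: "Range (B \<odot>\<^sub>o closure (M \<mu>) -\<^sub>o scalar_op 1) = UNIV"
    and ranM: "B `` Range (closure (M \<mu>)) \<subseteq> Range \<Gamma>\<^sub>0"
    and ran1: "B `` Range \<Gamma>\<^sub>1 \<subseteq> Range \<Gamma>\<^sub>0"
  shows "Range (A\<^sub>B -\<^sub>o scalar_op \<mu>) = UNIV"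
proof -
  have "h \<in> Range (A\<^sub>B -\<^sub>o scalar_op \<mu>)" for h
  proof -
    obtain k where "(k, h + \<mu> *\<^sub>C k) \<in> A\<^sub>0" using surj0 by (rule surj_op_diff_scalarE)
    then have k: "(k, h + \<mu> *\<^sub>C k) \<in> T" "(k, 0) \<in> \<Gamma>\<^sub>0" by (auto simp: mem_op_restrict_ker)
    obtain b where b: "(k, b) \<in> \<Gamma>\<^sub>1" using boundary_values[OF k(1)] .
    obtain c where c: "(b, c) \<in> B" using domain_B by blast
    obtain \<phi> where "(\<phi>, - c + 1 *\<^sub>C \<phi>) \<in> B \<odot>\<^sub>o closure (M \<mu>)"
      using surjM by (rule surj_op_diff_scalarE)
    then obtain \<psi> where \<psi>: "(\<phi>, \<psi>) \<in> closure (M \<mu>)" "(\<psi>, \<phi> - c) \<in> B"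
      by (auto simp: op_mult_def)
    have "\<phi> - c \<in> Range \<Gamma>\<^sub>0" "c \<in> Range \<Gamma>\<^sub>0" using ranM ran1 \<psi> b c by blast+
    then have "(\<phi> - c) + c \<in> Range \<Gamma>\<^sub>0"
      using linear_operator_add[OF lin(2)] by (meson Range_iff)
    then obtain g where g: "(g, \<mu> *\<^sub>C g) \<in> T" "(g, \<phi>) \<in> \<Gamma>\<^sub>0"
      using eigenvector_with_boundary_value[OF surj0] by auto
    obtain d where d: "(g, d) \<in> \<Gamma>\<^sub>1" using boundary_values[OF g(1)] .
    have "(\<phi>, d) \<in> M \<mu>" using g d by (auto simp: mem_weyl_function)
    then have "d = \<psi>"
      using closure_weyl_function_unique[OF surj0] \<psi>(1) closure_subset by blast
    then have "(b + d, c + (\<phi> - c)) \<in> B" using linear_operator_add[OF lin_B c \<psi>(2)] by simp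
    moreover have "(k + g, 0 + \<phi>) \<in> \<Gamma>\<^sub>0" "(k + g, b + d) \<in> \<Gamma>\<^sub>1"
      "(k + g, (h + \<mu> *\<^sub>C k) + \<mu> *\<^sub>C g) \<in> T"
      using linear_operator_add lin k b g d by blast+
    ultimately have "(k + g, h + \<mu> *\<^sub>C (k + g)) \<in> A\<^sub>B"
      by (auto simp: mem_boundary_extension scaleC_add_right add.assoc)
    then show ?thesis by (auto simp: Range_iff mem_op_diff_scalar)
  qed
  then show ?thesis by blast
qed

text \<open>
  If \<open>A\<^sub>1 - \<mu>\<close> is onto, every element of the domain of \<open>T\<close> has the same value under
  \<open>\<Gamma>\<^sub>1\<close> as some eigenvector for \<open>\<mu>\<close>.
\<close>

lemma range_\<Gamma>1_subset_range_weyl: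
  assumes "Range (A\<^sub>1 -\<^sub>o scalar_op \<mu>) = UNIV"
  shows "Range \<Gamma>\<^sub>1 \<subseteq> Range (M \<mu>)"
proof
  fix b assume "b \<in> Range \<Gamma>\<^sub>1"
  then obtain f f' where f: "(f, b) \<in> \<Gamma>\<^sub>1" "(f, f') \<in> T" using in_domain by blast
  obtain k where k: "(k, 0) \<in> \<Gamma>\<^sub>1" "(f - k, \<mu> *\<^sub>C (f - k)) \<in> T"
    using ker_decomposition[OF lin(1) assms f(2)] .
  have "(f - k, b) \<in> \<Gamma>\<^sub>1" using linear_operator_diff[OF lin(3) f(1) k(1)] by simp
  moreover obtain a where "(f - k, a) \<in> \<Gamma>\<^sub>0" using boundary_values[OF k(2)] .
  ultimately show "b \<in> Range (M \<mu>)" using k(2) by (auto simp: Range_iff mem_weyl_function)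
qed

lemma mem_Id_minus_BM:
  "(\<phi>, \<xi>) \<in> Id -\<^sub>o B \<odot>\<^sub>o M \<mu> \<longleftrightarrow>
     (\<exists>g d. (g, \<mu> *\<^sub>C g) \<in> T \<and> (g, \<phi>) \<in> \<Gamma>\<^sub>0 \<and> (g, d) \<in> \<Gamma>\<^sub>1 \<and> (d, \<phi> - \<xi>) \<in> B)"
proof -
  have "(\<phi>, \<xi>) \<in> Id -\<^sub>o B \<odot>\<^sub>o M \<mu> \<longleftrightarrow> (\<exists>c. \<xi> = \<phi> - c \<and> (\<phi>, c) \<in> B \<odot>\<^sub>o M \<mu>)"
    by (auto simp: op_diff_def)
  also have "\<dots> \<longleftrightarrow> (\<phi>, \<phi> - \<xi>) \<in> B \<odot>\<^sub>o M \<mu>" by (auto intro!: exI[of _ "\<phi> - \<xi>"])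
  also have "\<dots> \<longleftrightarrow> (\<exists>g d. (g, \<mu> *\<^sub>C g) \<in> T \<and> (g, \<phi>) \<in> \<Gamma>\<^sub>0 \<and> (g, d) \<in> \<Gamma>\<^sub>1 \<and> (d, \<phi> - \<xi>) \<in> B)"
    by (auto simp: op_mult_def relcomp_unfold mem_weyl_function)
  finally show ?thesis .
qed

text \<open>If \<open>B M(\<mu>) \<phi> = \<phi>\<close>, then \<open>\<gamma>(\<mu>) \<phi>\<close> is an eigenvector of \<open>A\<^sub>B\<close>.\<close>

lemma injective_Id_minus_BM:
  assumes inj: "op_injective (A\<^sub>B -\<^sub>o scalar_op \<mu>)"
  shows "op_injective (Id -\<^sub>o B \<odot>\<^sub>o M \<mu>)"
  unfolding op_injective_def single_valued_def
proof (intro allI impI, simp only: converse_iff)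
  fix \<xi> \<phi> \<phi>' assume "(\<phi>, \<xi>) \<in> Id -\<^sub>o B \<odot>\<^sub>o M \<mu>" "(\<phi>', \<xi>) \<in> Id -\<^sub>o B \<odot>\<^sub>o M \<mu>"
  then obtain g d g' d' where g: "(g, \<mu> *\<^sub>C g) \<in> T" "(g, \<phi>) \<in> \<Gamma>\<^sub>0" "(g, d) \<in> \<Gamma>\<^sub>1" "(d, \<phi> - \<xi>) \<in> B"
    and g': "(g', \<mu> *\<^sub>C g') \<in> T" "(g', \<phi>') \<in> \<Gamma>\<^sub>0" "(g', d') \<in> \<Gamma>\<^sub>1" "(d', \<phi>' - \<xi>) \<in> B"
    unfolding mem_Id_minus_BM by blast
  have diff: "(g - g', \<mu> *\<^sub>C g - \<mu> *\<^sub>C g') \<in> T" "(g - g', \<phi> - \<phi>') \<in> \<Gamma>\<^sub>0" "(g - g', d - d') \<in> \<Gamma>\<^sub>1"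
    "(d - d', (\<phi> - \<xi>) - (\<phi>' - \<xi>)) \<in> B"
    using linear_operator_diff lin lin_B g g' by blast+
  then have "(g - g', 0 + \<mu> *\<^sub>C (g - g')) \<in> A\<^sub>B"
    by (auto simp: mem_boundary_extension scaleC_diff_right)
  moreover have "(0, 0 + \<mu> *\<^sub>C 0) \<in> A\<^sub>B"
    using linear_operator_zero[OF linear_boundary_extension] by simp
  ultimately have "g - g' = 0"
    using inj unfolding op_injective_def single_valued_def converse_iff mem_op_diff_scalar
    by blast
  then have "(0, \<phi> - \<phi>') \<in> \<Gamma>\<^sub>0" using diff(2) by simp
  then have "\<phi> - \<phi>' = 0"
    using linear_operator_zero[OF lin(2)] linear_operator_unique[OF lin(2)] by blast
  then show "\<phi> = \<phi>'" by simp
qed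

text \<open>
  Subtracting \<open>(A\<^sub>0 - \<mu>)\<inverse> h\<close> from a solution
  of \<open>(A\<^sub>B - \<mu>) f = h\<close> leaves an eigenvector of \<open>T\<close>, and the boundary condition for \<open>f\<close> is the
  equation \<open>(I - B M(\<mu>)) \<phi> = B \<gamma>(cnj \<mu>)\<^sup>*\<^sub>o h\<close> for its boundary value \<open>\<phi>\<close>.
  Conversely, injectivity of \<open>A\<^sub>0 - \<mu>\<close> ensures that \<open>\<gamma>(\<mu>)\<close> and \<open>M(\<mu>)\<close> see the same eigenvector
  with boundary value \<open>\<phi>\<close>.
\<close>

lemma krein_formula:
  assumes inj0: "op_injective (A\<^sub>0 -\<^sub>o scalar_op \<mu>)"
    and surj0: "Range (A\<^sub>0 -\<^sub>o scalar_op \<mu>) = UNIV"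
  shows "(A\<^sub>B -\<^sub>o scalar_op \<mu>)\<inverse> =
    (A\<^sub>0 -\<^sub>o scalar_op \<mu>)\<inverse> +\<^sub>o
    \<gamma> \<mu> \<odot>\<^sub>o (Id -\<^sub>o B \<odot>\<^sub>o M \<mu>)\<inverse> \<odot>\<^sub>o B \<odot>\<^sub>o (\<gamma> (cnj \<mu>))\<^sup>*\<^sub>o" (is "?L = ?R1 +\<^sub>o ?R2")
proof -
  have R2: "(h, g) \<in> ?R2 \<longleftrightarrow> (\<exists>c e \<phi>. (h, c) \<in> (\<gamma> (cnj \<mu>))\<^sup>*\<^sub>o \<and> (c, e) \<in> B \<and>
      (\<phi>, e) \<in> Id -\<^sub>o B \<odot>\<^sub>o M \<mu> \<and> (\<phi>, g) \<in> \<gamma> \<mu>)" for h g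
    by (auto simp: op_mult_def relcomp_unfold)
  have "(h, f) \<in> ?L \<longleftrightarrow> (h, f) \<in> ?R1 +\<^sub>o ?R2" for h f
  proof
    assume "(h, f) \<in> ?L"
    then obtain a b where f: "(f, h + \<mu> *\<^sub>C f) \<in> T" "(f, a) \<in> \<Gamma>\<^sub>0" "(f, b) \<in> \<Gamma>\<^sub>1" "(b, a) \<in> B"
      by (auto simp: mem_op_diff_scalar mem_boundary_extension)
    obtain k where k0: "(k, h + \<mu> *\<^sub>C k) \<in> A\<^sub>0" using surj0 by (rule surj_op_diff_scalarE)
    then have k: "(k, h + \<mu> *\<^sub>C k) \<in> T" "(k, 0) \<in> \<Gamma>\<^sub>0" by (auto simp: mem_op_restrict_ker)
    obtain b' where b': "(k, b') \<in> \<Gamma>\<^sub>1" using boundary_values[OF k(1)] .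
    obtain c where c: "(b', c) \<in> B" using domain_B by blast
    have g: "(f - k, \<mu> *\<^sub>C (f - k)) \<in> T" "(f - k, a) \<in> \<Gamma>\<^sub>0" "(f - k, b - b') \<in> \<Gamma>\<^sub>1"
      using linear_operator_diff[OF lin(1) f(1) k(1)] linear_operator_diff[OF lin(2) f(2) k(2)]
        linear_operator_diff[OF lin(3) f(3) b'] by (simp_all add: scaleC_diff_right)
    have "(b - b', a - c) \<in> B" using linear_operator_diff[OF lin_B f(4) c] .
    then have "(a, c) \<in> Id -\<^sub>o B \<odot>\<^sub>o M \<mu>" using g by (auto simp: mem_Id_minus_BM)
    moreover have "(h, b') \<in> (\<gamma> (cnj \<mu>))\<^sup>*\<^sub>o" using adjoint_gamma_field[OF surj0 k0 b'] by simp
    moreover have "(a, f - k) \<in> \<gamma> \<mu>" using g by (simp add: mem_gamma_field)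
    ultimately have "(h, f - k) \<in> ?R2" using c R2 by blast
    moreover have "(h, k) \<in> ?R1" using k0 by (simp add: mem_op_diff_scalar)
    ultimately have "(h, k + (f - k)) \<in> ?R1 +\<^sub>o ?R2" unfolding op_add_def by blast
    then show "(h, f) \<in> ?R1 +\<^sub>o ?R2" by simp
  next
    assume "(h, f) \<in> ?R1 +\<^sub>o ?R2"
    then obtain k g where f: "f = k + g" and "(h, k) \<in> ?R1" and g: "(h, g) \<in> ?R2"
      unfolding op_add_def by blast
    then have k0: "(k, h + \<mu> *\<^sub>C k) \<in> A\<^sub>0" by (simp add: mem_op_diff_scalar)
    then have k: "(k, h + \<mu> *\<^sub>C k) \<in> T" "(k, 0) \<in> \<Gamma>\<^sub>0" by (auto simp: mem_op_restrict_ker)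
    obtain b where b: "(k, b) \<in> \<Gamma>\<^sub>1" using boundary_values[OF k(1)] .
    obtain e \<phi> where e: "(b, e) \<in> B" "(\<phi>, e) \<in> Id -\<^sub>o B \<odot>\<^sub>o M \<mu>" and g: "(\<phi>, g) \<in> \<gamma> \<mu>"
      using g unfolding R2 adjoint_gamma_field[OF surj0 k0 b] by blast
    have g: "(g, \<mu> *\<^sub>C g) \<in> T" "(g, \<phi>) \<in> \<Gamma>\<^sub>0" using g by (simp_all add: mem_gamma_field)
    obtain g' d where g': "(g', \<mu> *\<^sub>C g') \<in> T" "(g', \<phi>) \<in> \<Gamma>\<^sub>0" "(g', d) \<in> \<Gamma>\<^sub>1" "(d, \<phi> - e) \<in> B"
      using e(2) unfolding mem_Id_minus_BM by blast
    have "(g - g', 0 + \<mu> *\<^sub>C (g - g')) \<in> A\<^sub>0" "(0, 0 + \<mu> *\<^sub>C 0) \<in> A\<^sub>0"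
      using linear_operator_diff[OF lin(1) g(1) g'(1)] linear_operator_diff[OF lin(2) g(2) g'(2)]
        linear_operator_zero[OF lin(1)] linear_operator_zero[OF lin(2)]
      by (simp_all add: mem_op_restrict_ker scaleC_diff_right)
    then have "g - g' = 0"
      using inj0 unfolding op_injective_def single_valued_def converse_iff mem_op_diff_scalar
      by blast
    then have d: "(g, d) \<in> \<Gamma>\<^sub>1" using g'(3) by simp
    have "(b + d, e + (\<phi> - e)) \<in> B" using linear_operator_add[OF lin_B e(1) g'(4)] .
    moreover have "(k + g, 0 + \<phi>) \<in> \<Gamma>\<^sub>0" "(k + g, b + d) \<in> \<Gamma>\<^sub>1"
      "(k + g, (h + \<mu> *\<^sub>C k) + \<mu> *\<^sub>C g) \<in> T"
      using linear_operator_add lin k b g d by blast+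
    ultimately have "(f, h + \<mu> *\<^sub>C f) \<in> A\<^sub>B"
      by (auto simp: f mem_boundary_extension scaleC_add_right add.assoc)
    then show "(h, f) \<in> ?L" by (simp add: mem_op_diff_scalar)
  qed
  then show ?thesis by auto
qed

end

section \<open>Self-adjointness and the resolvent formula\<close>

theorem corollary2p5:
  fixes S T :: "('h::complex_hilbert \<times> 'h) set"
    and \<Gamma>\<^sub>0 \<Gamma>\<^sub>1 :: "('h \<times> 'g::complex_hilbert) set"
    and B :: "('g \<times> 'g) set"
    and \<mu>\<^sub>p \<mu>\<^sub>m :: complex
  defines "A\<^sub>0 \<equiv> T \<restriction>\<^sub>o op_ker \<Gamma>\<^sub>0"
    and "A\<^sub>1 \<equiv> T \<restriction>\<^sub>o op_ker \<Gamma>\<^sub>1"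
    and "\<gamma> \<equiv> gamma_field T \<Gamma>\<^sub>0"
    and "M \<equiv> weyl_function T \<Gamma>\<^sub>0 \<Gamma>\<^sub>1"
    and "A\<^sub>B \<equiv> boundary_extension T \<Gamma>\<^sub>0 \<Gamma>\<^sub>1 B"
  assumes "linear_operator S" and "densely_defined S" and "closed S" and "symmetric_operator S"
    and "quasi_boundary_triple S T \<Gamma>\<^sub>0 \<Gamma>\<^sub>1"
    and "self_adjoint B" and "Domain B = UNIV" and "op_bounded B"
    and "Im \<mu>\<^sub>p > 0" and "Im \<mu>\<^sub>m < 0"
    and "\<forall>\<mu> \<in> {\<mu>\<^sub>p, \<mu>\<^sub>m}. 1 \<in> resolvent_set (B \<odot>\<^sub>o closure (M \<mu>))"
    and "\<forall>\<mu> \<in> {\<mu>\<^sub>p, \<mu>\<^sub>m}. B `` Range (closure (M \<mu>)) \<subseteq> Range \<Gamma>\<^sub>0"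
    and "B `` Range \<Gamma>\<^sub>1 \<subseteq> Range \<Gamma>\<^sub>0 \<or> self_adjoint A\<^sub>1"
  shows "self_adjoint A\<^sub>B \<and> S \<subseteq> A\<^sub>B \<and>
    (\<forall>\<mu> \<in> resolvent_set A\<^sub>B \<inter> resolvent_set A\<^sub>0.
       op_injective (Id -\<^sub>o B \<odot>\<^sub>o M \<mu>) \<and>
       (A\<^sub>B -\<^sub>o scalar_op \<mu>)\<inverse> =
         (A\<^sub>0 -\<^sub>o scalar_op \<mu>)\<inverse> +\<^sub>o
         \<gamma> \<mu> \<odot>\<^sub>o (Id -\<^sub>o B \<odot>\<^sub>o M \<mu>)\<inverse> \<odot>\<^sub>o B \<odot>\<^sub>o (\<gamma> (cnj \<mu>))\<^sup>*\<^sub>o)"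
proof -
  interpret boundary_parameter S T \<Gamma>\<^sub>0 \<Gamma>\<^sub>1 B
    by unfold_locales (use assms in auto)
  note defs = A\<^sub>0_def A\<^sub>1_def \<gamma>_def M_def A\<^sub>B_def
  have im: "Im \<mu> \<noteq> 0" if "\<mu> \<in> {\<mu>\<^sub>p, \<mu>\<^sub>m}" for \<mu>
    using that assms(14,15) by auto
  have ranM: "B `` Range (closure (M \<mu>)) \<subseteq> Range \<Gamma>\<^sub>0" if "\<mu> \<in> {\<mu>\<^sub>p, \<mu>\<^sub>m}" for \<mu>
    using assms(17) that by blast
  have ran1: "B `` Range \<Gamma>\<^sub>1 \<subseteq> Range \<Gamma>\<^sub>0"
    using assms(18)
  proof
    assume "self_adjoint A\<^sub>1"
    then have "Range (A\<^sub>1 -\<^sub>o scalar_op \<mu>\<^sub>p) = UNIV" by (rule self_adjoint_surj) (simp add: im)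
    then have "Range \<Gamma>\<^sub>1 \<subseteq> Range (closure (M \<mu>\<^sub>p))"
      using range_\<Gamma>1_subset_range_weyl closure_subset unfolding defs by blast
    then show ?thesis using ranM[of \<mu>\<^sub>p] by blast
  qed
  have surj: "Range (A\<^sub>B -\<^sub>o scalar_op \<mu>) = UNIV" if \<mu>: "\<mu> \<in> {\<mu>\<^sub>p, \<mu>\<^sub>m}" for \<mu>
    unfolding A\<^sub>B_def
  proof (rule boundary_extension_surj)
    show "Range (T \<restriction>\<^sub>o op_ker \<Gamma>\<^sub>0 -\<^sub>o scalar_op \<mu>) = UNIV"
      using self_adjoint_surj[OF self_adjoint_A0 im[OF \<mu>]] .
    show "Range (B \<odot>\<^sub>o closure (weyl_function T \<Gamma>\<^sub>0 \<Gamma>\<^sub>1 \<mu>) -\<^sub>o scalar_op 1) = UNIV"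
      using assms(16) \<mu> unfolding resolvent_set_def M_def by blast
    show "B `` Range (closure (weyl_function T \<Gamma>\<^sub>0 \<Gamma>\<^sub>1 \<mu>)) \<subseteq> Range \<Gamma>\<^sub>0"
      using ranM[OF \<mu>] unfolding M_def .
  qed (rule ran1)
  have ext: "S \<subseteq> A\<^sub>B" using extends_minimal_operator unfolding A\<^sub>B_def .
  have "closure (Domain S) \<subseteq> closure (Domain A\<^sub>B)"
    using ext by (intro closure_mono) blast
  then have "densely_defined A\<^sub>B"
    using \<open>densely_defined S\<close> unfolding densely_defined_def by blast
  moreover have "A\<^sub>B\<^sup>*\<^sub>o = A\<^sub>B"
    using symmetric_boundary_extension surj assms(14,15) unfolding A\<^sub>B_def
    by (intro symmetric_surj_imp_adjoint_eq[of _ \<mu>\<^sub>p \<mu>\<^sub>m]) auto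
  ultimately have "self_adjoint A\<^sub>B"
    using linear_boundary_extension unfolding self_adjoint_def A\<^sub>B_def by blast
  moreover have "op_injective (Id -\<^sub>o B \<odot>\<^sub>o M \<mu>) \<and>
       (A\<^sub>B -\<^sub>o scalar_op \<mu>)\<inverse> =
         (A\<^sub>0 -\<^sub>o scalar_op \<mu>)\<inverse> +\<^sub>o
         \<gamma> \<mu> \<odot>\<^sub>o (Id -\<^sub>o B \<odot>\<^sub>o M \<mu>)\<inverse> \<odot>\<^sub>o B \<odot>\<^sub>o (\<gamma> (cnj \<mu>))\<^sup>*\<^sub>o"
    if "\<mu> \<in> resolvent_set A\<^sub>B \<inter> resolvent_set A\<^sub>0" for \<mu>
    using that injective_Id_minus_BM[of \<mu>] krein_formula[of \<mu>]
    unfolding defs resolvent_set_def by simp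
  ultimately show ?thesis using ext by blast
qed

end
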